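(* Let $n\in\mathbb{N}$, $n\ge 1$. Let $I$ be an interval, with $I\subseteq[-\infty,\infty]$ if $n=1$ and $I\subseteq\mathbb{R}$ if $n\neq 1$, let $c\in I$, and let $f,g\colon I\to\mathbb{R}$ be two functions such that (i) $f$ and $g$ are both locally Lebesgue integrable on $I$, and (ii) $g$ preserves Lebesgue-almost everywhere a non-zero sign. If $\frac{f}{g}\colon I\to[-\infty,\infty]$ is Lebesgue-almost everywhere monotonic (respectively, Lebesgue-almost everywhere strictly monotonic), then the function $$\frac{A_{n,f,c}}{A_{n,g,c}}\colon I\setminus\{c\}\to\mathbb{R}$$ is monotonic (respectively, strictly monotonic) on $I\setminus\{c\}$, of the same monotonicity: it is increasing, decreasing, strictly increasing or strictly decreasing whenever $\frac{f}{g}$ is so Lebesgue-almost everywhere.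
   Context: For $n\in\mathbb{N}$, an interval $I$ as in the claim, $c\in I$ and a locally Lebesgue integrable $f\colon I\to\mathbb{R}$, the antiderivative of order $n$ for $f$ at $c$ is $$A_{n,f,c}\colon I\to\mathbb{R},\qquad A_{n,f,c}(x)=\frac{1}{(n-1)!}\int_c^x f(t)(x-t)^{n-1}\,\mathrm{d}t,$$ where for $n=1$ the factor $(x-t)^{0}$ is $1$, so $A_{1,f,c}(x)=\int_c^x f(t)\,\mathrm{d}t$. Integrals are oriented: $\int_c^x=-\int_x^c$. Intervals in $[-\infty,\infty]$ may contain $\pm\infty$. A function on an interval $I\subseteq[-\infty,\infty]$ has a property locally if it has it on every compact subinterval of $I$; unbounded intervals of the form $[-\infty,\infty]$, $[-\infty,a]$, $[a,\infty]$ with $a\in\mathbb{R}$ are compact. Thus $f$ is locally Lebesgue integrable on $I$ if it is Lebesgue integrable on every compact subinterval of $I$. "$g$ preserves Lebesgue-almost everywhere a non-zero sign" means that either $g>0$ almost everywhere on $I$ or $g<0$ almost everywhere on $I$. A function is Lebesgue-almost everywhere (strictly) monotonic on $I$ if its restriction to the complement in $I$ of some Lebesgue-null set is (strictly) monotonic; the values of $f/g$ on the null set where $g=0$ are irrelevant. "Increasing" and "decreasing" without "strictly" are in the weak sense. *)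

theory Defs
  imports "HOL-Analysis.Analysis"
begin

text \<open>
  Intervals in the extended real line are order-convex sets of type \<^typ>\<open>ereal set\<close>; they may
  contain the infinite points, be open, half-open or closed, and be degenerate. Functions on an
  interval \<open>I\<close> are total functions on \<^typ>\<open>ereal\<close> of which only the values on \<open>I\<close> are used.
\<close>

definition ereal_interval :: "ereal set \<Rightarrow> bool" where
  "ereal_interval I \<longleftrightarrow> (\<forall>x\<in>I. \<forall>y\<in>I. {x..y} \<subseteq> I)"

text \<open>
  Lebesgue measure on the extended real line is carried by the finite points, so a set \<open>K\<close> of
  extended reals is measured through its trace \<open>ereal -` K\<close> on the real line; in particular the
  points \<open>\<infinity>\<close> and \<open>-\<infinity>\<close> form a null set. Compactness of \<open>K\<close> refers to the topology of the
  extended reals, in which e.g. \<open>{a..\<infinity>}\<close> is compact.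
\<close>

definition locally_lebesgue_integrable_on :: "ereal set \<Rightarrow> (ereal \<Rightarrow> real) \<Rightarrow> bool" where
  "locally_lebesgue_integrable_on I f \<longleftrightarrow>
     (\<forall>K. K \<subseteq> I \<and> ereal_interval K \<and> compact K \<longrightarrow>
        set_integrable lebesgue (ereal -` K) (\<lambda>t. f (ereal t)))"

definition preserves_nonzero_sign_ae_on :: "ereal set \<Rightarrow> (ereal \<Rightarrow> real) \<Rightarrow> bool" where
  "preserves_nonzero_sign_ae_on I g \<longleftrightarrow>
     (AE t in lebesgue. ereal t \<in> I \<longrightarrow> g (ereal t) > 0) \<or>
     (AE t in lebesgue. ereal t \<in> I \<longrightarrow> g (ereal t) < 0)"

text \<open>
  The parameter \<open>R\<close> is the property the restricted function is required to have on the set: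
  \<open>mono_on\<close>, \<open>antimono_on\<close>, \<open>strict_mono_on\<close> or \<open>strict_antimono_on\<close>.
\<close>

definition off_null_set_on ::
    "(ereal set \<Rightarrow> (ereal \<Rightarrow> 'b) \<Rightarrow> bool) \<Rightarrow> ereal set \<Rightarrow> (ereal \<Rightarrow> 'b) \<Rightarrow> bool" where
  "off_null_set_on R I h \<longleftrightarrow> (\<exists>N. ereal -` N \<in> null_sets lebesgue \<and> R (I - N) h)"

text \<open>
  The interval integral is oriented. The integrand only involves finite \<open>t\<close>. At \<open>x = \<infinity>\<close> or
  \<open>x = -\<infinity>\<close>, where \<^const>\<open>real_of_ereal\<close> has the default value \<open>0\<close>, the definition is meant for
  \<open>n = 1\<close> only; there the factor \<open>(x - t) ^ 0\<close> is \<open>1\<close>. The index satisfies \<open>n \<ge> 1\<close>.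
\<close>

definition antideriv :: "nat \<Rightarrow> (ereal \<Rightarrow> real) \<Rightarrow> ereal \<Rightarrow> ereal \<Rightarrow> real" where
  "antideriv n f c x =
     1 / fact (n - 1) * (LINT t=c..x|lebesgue. (f (ereal t) * (real_of_ereal x - t) ^ (n - 1)))"

end

theory Submission
  imports Defs
begin

text \<open>
  For \<open>x\<close> in \<open>I - {c}\<close>, the quotient of the two antiderivatives is the average of \<open>f / g\<close> with
  respect to the weight \<open>g(t) k\<^sub>x(t)\<close>, where \<open>k\<^sub>x(t) = |x - t| ^ (n - 1)\<close> for \<open>t\<close> between \<open>c\<close> and
  \<open>x\<close> and \<open>k\<^sub>x(t) = 0\<close> elsewhere: the factor \<open>1 / (n - 1)!\<close>, the orientation of the integral and
  the sign of \<open>(x - t) ^ (n - 1)\<close> are the same in numerator and denominator and cancel. As \<open>x\<close>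
  grows, this weight moves to the right in the sense of the monotone likelihood ratio,
  \<open>k\<^sub>x(t) k\<^sub>y(s) \<le> k\<^sub>x(s) k\<^sub>y(t)\<close> for \<open>x < y\<close> and \<open>s < t\<close> (lemma \<open>kernel_ratio_mono\<close>). This holds
  for \<open>x\<close> and \<open>y\<close> on the same side of \<open>c\<close> and, the supports being disjoint, also on different sides.

  Averaging an increasing function against a weight that moves to the right gives an increasing
  result (lemma \<open>kernel_average_crossing\<close>). Indeed the difference \<open>d\<close> of two such normalised
  weights has integral zero and changes sign once, from negative to positive. If \<open>\<kappa>\<close> separates
  the values of \<open>q = f / g\<close> on \<open>{d < 0}\<close> from those on \<open>{d > 0}\<close>, then \<open>(q - \<kappa>) d \<ge> 0\<close>, and
  the integral of \<open>q d\<close> equals that of \<open>(q - \<kappa>) d\<close>. It vanishes only if \<open>q = \<kappa>\<close> almost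
  everywhere on \<open>{d \<noteq> 0}\<close>; both signs of \<open>d\<close> occur on sets of positive measure, because for
  \<open>x \<noteq> y\<close> the supports of \<open>k\<^sub>x\<close> and \<open>k\<^sub>y\<close> differ by an interval. So equality of the averages produces
  points \<open>s < t\<close> with \<open>q(s) = \<kappa> = q(t)\<close>, which a strictly monotonic \<open>q\<close> does not have.

  A decreasing quotient is reduced to an increasing one by negating \<open>f\<close>, and a negative \<open>g\<close> to a
  positive one by negating \<open>f\<close> and \<open>g\<close>.
\<close>

section \<open>Averages against weights with monotone likelihood ratio\<close>

text \<open>
  The inequality compares the averages of \<open>f / g\<close> for the weights \<open>g k\<close> and \<open>g l\<close>, cleared of
  denominators. The quotient \<open>l / k\<close> is increasing by \<open>ratio\<close>, so the signed weight
  \<open>d = a g l - b g k\<close>, which has integral zero, is negative before it is positive. The case of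
  equality is described by a pair of points, so that the same lemma serves the weak and the
  strict version.
\<close>

lemma kernel_average_crossing:
  fixes f g k l :: "'a::linorder \<Rightarrow> real"
  assumes int: "integrable M (\<lambda>t. f t * k t)" "integrable M (\<lambda>t. f t * l t)"
      "integrable M (\<lambda>t. g t * k t)" "integrable M (\<lambda>t. g t * l t)"
    and supp: "AE t in M. t \<notin> A \<longrightarrow> k t = 0 \<and> l t = 0"
    and g_pos: "\<And>t. t \<in> A \<Longrightarrow> g t > 0"
    and nonneg: "\<And>t. k t \<ge> 0" "\<And>t. l t \<ge> 0"
    and ratio: "\<And>s t. s < t \<Longrightarrow> k t * l s \<le> k s * l t"
    and q_mono: "\<And>s t. s \<in> A \<Longrightarrow> t \<in> A \<Longrightarrow> s < t \<Longrightarrow> f s / g s \<le> f t / g t"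
  defines "a \<equiv> LINT t|M. g t * k t" and "b \<equiv> LINT t|M. g t * l t"
  assumes noteq: "\<not> (AE t in M. a * l t = b * k t)"
  shows "(LINT t|M. f t * k t) * b \<le> (LINT t|M. f t * l t) * a"
    and "(LINT t|M. f t * k t) * b = (LINT t|M. f t * l t) * a \<Longrightarrow>
      \<exists>s\<in>A. \<exists>t\<in>A. s < t \<and> f s / g s = f t / g t"
proof -
  \<comment> \<open>In these terms \<open>e = q d\<close> almost everywhere, and the claim says that \<open>e\<close> has a nonnegative
    integral.\<close>
  define d where "d t = a * (g t * l t) - b * (g t * k t)" for t
  define e where "e t = a * (f t * l t) - b * (f t * k t)" for t
  define q where "q t = f t / g t" for t
  have [simp]: "integrable M d" "integrable M e"
    using int by (simp_all add: d_def[abs_def] e_def[abs_def])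
  have d_int: "integral\<^sup>L M d = 0"
    using int by (simp add: d_def[abs_def] a_def b_def)
  have e_int: "integral\<^sup>L M e = (LINT t|M. f t * l t) * a - (LINT t|M. f t * k t) * b"
    using int by (simp add: e_def[abs_def])
  have wsupp: "AE t in M. g t * k t \<ge> 0" "AE t in M. g t * l t \<ge> 0"
    using supp by (eventually_elim, use g_pos nonneg in \<open>auto simp: less_imp_le\<close>)+
  have a0: "a \<ge> 0" and b0: "b \<ge> 0"
    unfolding a_def b_def using wsupp by (auto intro: integral_nonneg_AE)
  have d_A: "d t = g t * (a * l t - b * k t)" for t by (simp add: d_def algebra_simps)
  have nz: "\<not> (AE t in M. d t = 0)"
  proof
    assume "AE t in M. d t = 0"
    with supp have "AE t in M. a * l t = b * k t"
    proof eventually_elim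
      case (elim t)
      show ?case
      proof (cases "t \<in> A")
        case True
        from elim(2) g_pos[OF True] show ?thesis unfolding d_A by simp
      qed (use elim in auto)
    qed
    with noteq show False ..
  qed
  have dsupp: "AE t in M. t \<notin> A \<longrightarrow> d t = 0"
    using supp by eventually_elim (auto simp: d_def)
  \<comment> \<open>If the two points were in the wrong order, the ratio condition at \<open>t < s\<close> would carry the
    inequality \<open>b k \<le> a l\<close> from \<open>t\<close> over to \<open>s\<close>.\<close>
  have cross: "s < t" if "s \<in> A" "t \<in> A" "d s < 0" "d t > 0" for s t
  proof (rule ccontr)
    assume "\<not> s < t"
    with that have "t < s" by (metis less_asym' neqE)
    have "a * l t > b * k t" "a * l s < b * k s"
      using that g_pos[of s] g_pos[of t] unfolding d_A
      by (auto simp: zero_less_mult_iff mult_less_0_iff)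
    moreover have "b * k s * l t \<le> b * k t * l s"
      using mult_left_mono[OF ratio[OF \<open>t < s\<close>] b0] by (simp add: mult_ac)
    moreover have "l t > 0"
    proof (rule ccontr)
      assume "\<not> l t > 0"
      with nonneg(2)[of t] have "l t = 0" by simp
      with calculation(1) b0 nonneg(1)[of t] show False
        by (simp add: mult_less_0_iff)
    qed
    ultimately have "b * k s * l t \<le> a * l t * l s" 
      by (meson mult_right_mono nonneg(2) less_imp_le order_trans)
    then have "(b * k s) * l t \<le> (a * l s) * l t" by (simp add: mult_ac)
    with \<open>l t > 0\<close> have "b * k s \<le> a * l s" by simp
    with \<open>a * l s < b * k s\<close> show False by simp
  qed
  \<comment> \<open>Since \<open>d\<close> has integral zero without vanishing almost everywhere, neither \<open>{d < 0}\<close> nor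
    \<open>{d > 0}\<close> is null; so both contain points with any property that holds almost everywhere on \<open>{d \<noteq> 0}\<close>.\<close>
  have ex_neg: "\<exists>s\<in>A. d s < 0 \<and> P s" if "AE t in M. d t \<noteq> 0 \<longrightarrow> P t" for P
  proof (rule ccontr)
    assume no: "\<not> ?thesis"
    from dsupp that have "AE t in M. d t \<ge> 0"
      by eventually_elim (use no in fastforce)
    with d_int have "AE t in M. d t = 0" by (subst (asm) integral_nonneg_eq_0_iff_AE) auto
    with nz show False ..
  qed
  have ex_pos: "\<exists>s\<in>A. d s > 0 \<and> P s" if "AE t in M. d t \<noteq> 0 \<longrightarrow> P t" for P
  proof (rule ccontr)
    assume no: "\<not> ?thesis"
    from dsupp that have "AE t in M. - d t \<ge> 0"
      by eventually_elim (use no in fastforce)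
    moreover have "integral\<^sup>L M (\<lambda>t. - d t) = 0" using d_int by simp
    ultimately have "AE t in M. - d t = 0" by (subst (asm) integral_nonneg_eq_0_iff_AE) auto
    with nz show False by simp
  qed
  \<comment> \<open>The supremum is finite because the values of \<open>q\<close> on \<open>{d > 0}\<close> are upper bounds.\<close>
  define \<kappa> where "\<kappa> = Sup (q ` {s\<in>A. d s < 0})"
  obtain s0 where s0: "s0 \<in> A" "d s0 < 0" using ex_neg[of "\<lambda>_. True"] by auto
  obtain t0 where t0: "t0 \<in> A" "d t0 > 0" using ex_pos[of "\<lambda>_. True"] by auto
  have q_cross: "q s \<le> q t" if "s \<in> A" "t \<in> A" "d s < 0" "d t > 0" for s t
    using q_mono cross that by (simp add: q_def)
  have below: "q s \<le> \<kappa>" if "s \<in> A" "d s < 0" for s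
    unfolding \<kappa>_def
  proof (rule cSup_upper)
    show "bdd_above (q ` {s \<in> A. d s < 0})" using q_cross t0 by (intro bdd_aboveI[of _ "q t0"]) auto
  qed (use that in auto)
  have above: "\<kappa> \<le> q t" if "t \<in> A" "d t > 0" for t
    unfolding \<kappa>_def using s0 q_cross that by (intro cSup_least) auto
  have e_eq: "AE t in M. e t - \<kappa> * d t = (q t - \<kappa>) * d t"
    using supp
  proof eventually_elim
    case (elim t)
    show ?case
    proof (cases "t \<in> A")
      case True
      from g_pos[OF True] show ?thesis by (simp add: q_def d_def e_def field_simps)
    qed (use elim in \<open>auto simp: d_def e_def\<close>)
  qed
  have ge: "AE t in M. e t - \<kappa> * d t \<ge> 0"
    using e_eq dsupp
  proof eventually_elim
    case (elim t)
    show ?case unfolding elim(1)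
      using elim(2) below[of t] above[of t]
      by (cases "d t" "0::real" rule: linorder_cases) (auto intro: mult_nonpos_nonpos)
  qed
  have e_int': "(LINT t|M. e t - \<kappa> * d t) = integral\<^sup>L M e" using d_int by simp
  have le: "integral\<^sup>L M e \<ge> 0" using integral_nonneg_AE[OF ge] e_int' by simp
  show "(LINT t|M. f t * k t) * b \<le> (LINT t|M. f t * l t) * a" using le e_int by simp
  assume "(LINT t|M. f t * k t) * b = (LINT t|M. f t * l t) * a"
  then have "integral\<^sup>L M (\<lambda>t. e t - \<kappa> * d t) = 0" using e_int e_int' by simp
  with ge have "AE t in M. e t - \<kappa> * d t = 0"
    by (subst (asm) integral_nonneg_eq_0_iff_AE) auto
  with e_eq have eq: "AE t in M. d t \<noteq> 0 \<longrightarrow> q t = \<kappa>" by eventually_elim auto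
  from ex_neg[OF eq] obtain s where s: "s \<in> A" "d s < 0" "q s = \<kappa>" by auto
  from ex_pos[OF eq] obtain t where t: "t \<in> A" "d t > 0" "q t = \<kappa>" by auto
  show "\<exists>s\<in>A. \<exists>t\<in>A. s < t \<and> f s / g s = f t / g t"
    using s t cross[of s t] unfolding q_def by metis
qed

section \<open>The kernel of the antiderivative\<close>

text \<open>
  The absolute value makes the kernel nonnegative on both sides of \<open>c\<close>. For \<open>n = 1\<close> it is the
  indicator of the interval, also at an infinite \<open>x\<close>, where \<^const>\<open>real_of_ereal\<close> gives no
  meaningful distance.
\<close>

definition power_kernel :: "nat \<Rightarrow> ereal \<Rightarrow> ereal \<Rightarrow> real \<Rightarrow> real" where
  "power_kernel n c x t =
     indicator (einterval (min c x) (max c x)) t * \<bar>real_of_ereal x - t\<bar> ^ (n - 1)"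

lemma kernel_nonneg: "power_kernel n c x t \<ge> 0"
  by (simp add: power_kernel_def)

lemma kernel_outside:
  assumes "\<not> (min c x < ereal t \<and> ereal t < max c x)"
  shows "power_kernel n c x t = 0"
  using assms by (auto simp: power_kernel_def einterval_iff)

lemma kernel_inside:
  assumes "min c x < ereal t" "ereal t < max c x"
  shows "power_kernel n c x t = \<bar>real_of_ereal x - t\<bar> ^ (n - 1)"
  using assms by (auto simp: power_kernel_def einterval_iff)

lemma kernel_pos:
  assumes "min c x < ereal t" "ereal t < max c x" "n \<noteq> 1 \<Longrightarrow> \<bar>x\<bar> \<noteq> \<infinity>"
  shows "power_kernel n c x t > 0"
proof (cases "n = 1")
  case False
  with assms(3) obtain r where "x = ereal r" by (cases x) auto
  with assms(1,2) have "real_of_ereal x \<noteq> t" by (auto simp: min_def max_def split: if_splits)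
  with assms show ?thesis by (simp add: kernel_inside)
qed (use assms in \<open>simp add: kernel_inside\<close>)

text \<open>
  For \<open>x < c\<close> the sign consists of \<open>-1\<close> from the orientation of the integral and of
  \<open>(-1) ^ (n - 1)\<close> from \<open>x - t < 0\<close>. It does not depend on the integrand.
\<close>

lemma antideriv_eq_kernel:
  assumes "n \<ge> 1" "n \<noteq> 1 \<Longrightarrow> \<bar>x\<bar> \<noteq> \<infinity>"
  shows "antideriv n h c x =
    (if c \<le> x then 1 else (-1) ^ n) / fact (n - 1) * (LINT t|lebesgue. h (ereal t) * power_kernel n c x t)"
proof (cases "c \<le> x")
  case True
  have eq: "indicator (einterval c x) t * (h (ereal t) * (real_of_ereal x - t) ^ (n - 1)) =
      h (ereal t) * power_kernel n c x t" for t
    using True assms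
    by (cases x; cases "n = 1")
       (auto simp: power_kernel_def min_def max_def einterval_iff indicator_def)
  have "(LINT t=c..x|lebesgue. (h (ereal t) * (real_of_ereal x - t) ^ (n - 1))) =
      (LINT t|lebesgue. h (ereal t) * power_kernel n c x t)"
    by (simp only: interval_lebesgue_integral_def set_lebesgue_integral_def if_True True
        real_scaleR_def eq)
  with True show ?thesis unfolding antideriv_def by simp
next
  case False
  have eq: "indicator (einterval x c) t * (h (ereal t) * (real_of_ereal x - t) ^ (n - 1)) =
      (-1) ^ (n - 1) * (h (ereal t) * power_kernel n c x t)" for t
  proof (cases "n = 1")
    case False
    with assms obtain r where r: "x = ereal r" by (cases x) auto
    show ?thesis
    proof (cases "r < t")
      case True
      then have "(r - t) ^ (n - 1) = (-1) ^ (n - 1) * \<bar>r - t\<bar> ^ (n - 1)"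
        by (simp flip: power_mult_distrib)
      then show ?thesis using \<open>\<not> c \<le> x\<close> r
        by (auto simp: power_kernel_def min_def max_def einterval_iff indicator_def)
    qed (use \<open>\<not> c \<le> x\<close> r in \<open>auto simp: power_kernel_def min_def max_def einterval_iff indicator_def\<close>)
  qed (use False in \<open>auto simp: power_kernel_def min_def max_def einterval_iff indicator_def\<close>)
  have "(LINT t=c..x|lebesgue. (h (ereal t) * (real_of_ereal x - t) ^ (n - 1))) =
      - ((-1) ^ (n - 1) * (LINT t|lebesgue. h (ereal t) * power_kernel n c x t))"
    by (simp only: interval_lebesgue_integral_def set_lebesgue_integral_def if_False False
        real_scaleR_def eq integral_mult_right_zero)
  moreover have "(-1::real) ^ n = - ((-1) ^ (n - 1))"
    using assms(1) by (cases n) auto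
  ultimately show ?thesis using False unfolding antideriv_def by simp
qed

lemma antideriv_quotient_eq_kernel:
  assumes "n \<ge> 1" "n \<noteq> 1 \<Longrightarrow> \<bar>x\<bar> \<noteq> \<infinity>"
  shows "antideriv n f c x / antideriv n g c x =
    (LINT t|lebesgue. f (ereal t) * power_kernel n c x t) / (LINT t|lebesgue. g (ereal t) * power_kernel n c x t)"
  using assms by (simp add: antideriv_eq_kernel)

lemma antideriv_uminus: "antideriv n (\<lambda>x. - h x) c x = - antideriv n h c x"
  by (simp only: antideriv_def mult_minus_left mult_minus_right interval_lebesgue_integral_uminus)

text \<open>
  The monotone likelihood ratio of the kernels. If the left-hand side is not zero, then \<open>s\<close> and
  \<open>t\<close> lie between \<open>c\<close> and both of \<open>x\<close>, \<open>y\<close>, which are then on the same side of \<open>c\<close>. There the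
  inequality is the \<open>(n - 1)\<close>-st power of one between products of distances, whose two sides
  differ by \<open>(y - x) (t - s)\<close>.
\<close>

lemma kernel_ratio_mono:
  assumes "x < y" "s < t" and fin: "n \<noteq> 1 \<Longrightarrow> \<bar>x\<bar> \<noteq> \<infinity>" "n \<noteq> 1 \<Longrightarrow> \<bar>y\<bar> \<noteq> \<infinity>"
  shows "power_kernel n c x t * power_kernel n c y s \<le> power_kernel n c x s * power_kernel n c y t"
proof (cases "min c x < ereal t \<and> ereal t < max c x \<and> min c y < ereal s \<and> ereal s < max c y")
  case False
  then have "power_kernel n c x t * power_kernel n c y s = 0"
    using kernel_outside[of c x t n] kernel_outside[of c y s n] by auto
  then show ?thesis
    using mult_nonneg_nonneg[OF kernel_nonneg[of n c x s] kernel_nonneg[of n c y t]] by linarith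
next
  case True
  have st: "ereal s < ereal t" using \<open>s < t\<close> by simp
  have inside: "min c x < ereal s" "ereal s < max c x" "min c y < ereal t" "ereal t < max c y"
    using True \<open>x < y\<close>
    by (auto simp: min_def max_def split: if_splits intro: less_trans[OF st] less_trans[OF _ st])
  have "(\<bar>real_of_ereal x - t\<bar> * \<bar>real_of_ereal y - s\<bar>) ^ (n - 1)
      \<le> (\<bar>real_of_ereal x - s\<bar> * \<bar>real_of_ereal y - t\<bar>) ^ (n - 1)"
  proof (cases "n = 1")
    case False
    with fin obtain a b where ab: "x = ereal a" "y = ereal b" by (cases x; cases y) auto
    have "\<bar>a - t\<bar> * \<bar>b - s\<bar> \<le> \<bar>a - s\<bar> * \<bar>b - t\<bar>"
    proof -
      have prod: "(b - a) * (t - s) \<ge> 0" using \<open>x < y\<close> \<open>s < t\<close> ab by simp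
      have "c \<le> x \<and> t < a \<and> s < b \<or> y \<le> c \<and> a < s \<and> b < s"
        using True inside ab \<open>x < y\<close> by (auto simp: min_def max_def split: if_splits)
      then show ?thesis
        using prod \<open>s < t\<close> \<open>x < y\<close> ab by (auto simp: algebra_simps)
    qed
    with ab show ?thesis by (auto intro: power_mono)
  qed simp
  with True inside show ?thesis
    by (simp add: kernel_inside power_mult_distrib)
qed

lemma kernel_bounded:
  assumes "n \<noteq> 1 \<Longrightarrow> \<bar>x\<bar> \<noteq> \<infinity> \<and> \<bar>c\<bar> \<noteq> \<infinity>"
  shows "\<exists>C. \<forall>t. power_kernel n c x t \<le> C"
proof (cases "n = 1")
  case True
  then show ?thesis by (intro exI[of _ 1]) (auto simp: power_kernel_def indicator_def)
next
  case False
  with assms obtain a b where ab: "x = ereal a" "c = ereal b" by (cases x; cases c) auto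
  show ?thesis
    by (intro exI[of _ "\<bar>a - b\<bar> ^ (n - 1)"])
       (auto simp: ab power_kernel_def indicator_def einterval_iff min_def max_def intro!: power_mono)
qed

lemma integrable_kernel:
  assumes I: "ereal_interval I" "n = 1 \<or> I \<subseteq> range ereal" "c \<in> I" "x \<in> I"
    and h: "locally_lebesgue_integrable_on I h"
  shows "integrable lebesgue (\<lambda>t. h (ereal t) * power_kernel n c x t)"
proof -
  let ?K = "{min c x..max c x}"
  have "?K \<subseteq> I" using I by (auto simp: ereal_interval_def min_def max_def)
  moreover have "ereal_interval ?K" by (auto simp: ereal_interval_def intro: order_trans)
  moreover have "compact ?K" by (simp add: compact_eq_closed)
  ultimately have "set_integrable lebesgue (ereal -` ?K) (\<lambda>t. h (ereal t))"
    using h by (auto simp: locally_lebesgue_integrable_on_def)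
  then have int: "integrable lebesgue (\<lambda>t. indicator (ereal -` ?K) t * h (ereal t))"
    by (simp add: set_integrable_def)
  obtain C where C: "\<And>t. power_kernel n c x t \<le> C"
    using kernel_bounded[of n x c] I(2-4) by fastforce
  have "(\<lambda>t. power_kernel n c x t) \<in> borel_measurable borel"
    unfolding power_kernel_def by measurable
  then have [measurable]: "(\<lambda>t. power_kernel n c x t) \<in> borel_measurable lebesgue"
    by (simp add: measurable_completion)
  have eq: "h (ereal t) * power_kernel n c x t = indicator (ereal -` ?K) t * h (ereal t) * power_kernel n c x t" for t
    using kernel_outside[of c x t n] less_imp_le[of "min c x" "ereal t"] less_imp_le[of "ereal t" "max c x"]
    by (cases "min c x < ereal t \<and> ereal t < max c x") (simp_all del: min_less_iff_conj less_max_iff_disj)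
  show ?thesis
    unfolding eq
  proof (rule Bochner_Integration.integrable_bound)
    show "integrable lebesgue (\<lambda>t. C * (indicator (ereal -` ?K) t * h (ereal t)))"
      using int by simp
    show "(\<lambda>t. indicator (ereal -` ?K) t * h (ereal t) * power_kernel n c x t) \<in> borel_measurable lebesgue"
      using borel_measurable_integrable[OF int] by measurable
    show "AE t in lebesgue. norm (indicator (ereal -` ?K) t * h (ereal t) * power_kernel n c x t)
        \<le> norm (C * (indicator (ereal -` ?K) t * h (ereal t)))"
    proof (intro AE_I2)
      fix t
      have "\<bar>power_kernel n c x t\<bar> \<le> \<bar>C\<bar>" using C[of t] kernel_nonneg[of n c x t] by linarith
      then show "norm (indicator (ereal -` ?K) t * h (ereal t) * power_kernel n c x t)
        \<le> norm (C * (indicator (ereal -` ?K) t * h (ereal t)))"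
        by (simp add: abs_mult mult.commute[of "\<bar>C\<bar>"] mult_left_mono)
    qed
  qed
qed

section \<open>Positivity and comparison of the weights\<close>

lemma AE_lebesgue_meets_einterval:
  assumes "AE t in lebesgue. P t" "u < v"
  obtains t where "u < ereal t" "ereal t < v" "P t"
proof -
  obtain N where N: "N \<in> null_sets lebesgue" "\<And>t. t \<notin> N \<Longrightarrow> P t"
    using AE_E3[OF assms(1)] by auto
  have "\<not> negligible (einterval u v)"
    using einterval_nonempty[OF assms(2)] by (intro open_not_negligible) auto
  then have "\<not> einterval u v \<subseteq> N"
    using N(1) negligible_subset by (auto simp: negligible_iff_null_sets)
  then obtain t where "t \<in> einterval u v" "t \<notin> N" by blast
  with N(2) that show ?thesis by (auto simp: einterval_iff)
qed

lemma min_max_in_interval: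
  assumes "ereal_interval I" "c \<in> I" "x \<in> I" "min c x < t" "t < max c x"
  shows "t \<in> I"
proof -
  have "{min c x..max c x} \<subseteq> I"
    using assms(1-3) by (auto simp: ereal_interval_def min_def max_def)
  moreover have "t \<in> {min c x..max c x}"
    using assms(4,5)[THEN less_imp_le] unfolding atLeastAtMost_iff by (rule conjI)
  ultimately show ?thesis by (rule subsetD)
qed

lemma kernel_integral_pos:
  assumes I: "ereal_interval I" "n = 1 \<or> I \<subseteq> range ereal" "c \<in> I" "x \<in> I" "x \<noteq> c"
    and g: "locally_lebesgue_integrable_on I g" "AE t in lebesgue. ereal t \<in> I \<longrightarrow> g (ereal t) > 0"
  shows "(LINT t|lebesgue. g (ereal t) * power_kernel n c x t) > 0"
proof -
  have nonneg: "AE t in lebesgue. g (ereal t) * power_kernel n c x t \<ge> 0"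
    using g(2)
  proof eventually_elim
    case (elim t)
    show ?case
      using elim kernel_outside[of c x t n] min_max_in_interval[OF I(1,3,4)] kernel_nonneg[of n c x t]
      by fastforce
  qed
  have "(LINT t|lebesgue. g (ereal t) * power_kernel n c x t) \<noteq> 0"
  proof
    assume "(LINT t|lebesgue. g (ereal t) * power_kernel n c x t) = 0"
    with nonneg integrable_kernel[OF I(1-4) g(1)]
    have "AE t in lebesgue. g (ereal t) * power_kernel n c x t = 0"
      by (subst (asm) integral_nonneg_eq_0_iff_AE) auto
    with g(2) have "AE t in lebesgue. ereal t \<in> I \<longrightarrow> power_kernel n c x t = 0"
      by eventually_elim auto
    moreover have "min c x < max c x" using \<open>x \<noteq> c\<close> by (auto simp: min_def max_def)
    ultimately obtain t where t: "min c x < ereal t" "ereal t < max c x"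
        "ereal t \<in> I \<longrightarrow> power_kernel n c x t = 0"
      by (rule AE_lebesgue_meets_einterval)
    with min_max_in_interval[OF I(1,3,4) t(1,2)] have "power_kernel n c x t = 0" by simp
    moreover have "power_kernel n c x t > 0"
      using I(2,4) by (intro kernel_pos t) auto
    ultimately show False by simp
  qed
  with integral_nonneg_AE[OF nonneg] show ?thesis by simp
qed

text \<open>
  On the interval from \<open>x\<close> to the nearer of \<open>y\<close> and \<open>c\<close> (if \<open>x < c\<close>), or from \<open>x\<close> to \<open>y\<close> (if
  \<open>c < x\<close>), exactly one of the two kernels vanishes.
\<close>

lemma kernels_not_proportional:
  assumes "x < y" "x \<noteq> c" "y \<noteq> c" and fin: "n \<noteq> 1 \<Longrightarrow> \<bar>x\<bar> \<noteq> \<infinity>" "n \<noteq> 1 \<Longrightarrow> \<bar>y\<bar> \<noteq> \<infinity>"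
    and "a > 0" "b > 0"
  shows "\<not> (AE t in lebesgue. a * power_kernel n c y t = b * power_kernel n c x t)"
proof
  assume ae: "AE t in lebesgue. a * power_kernel n c y t = b * power_kernel n c x t"
  show False
  proof (cases "x < c")
    case True
    then have "x < min c y" using assms by simp
    with ae obtain t where t: "x < ereal t" "ereal t < min c y"
        "a * power_kernel n c y t = b * power_kernel n c x t"
      by (rule AE_lebesgue_meets_einterval)
    with True have "power_kernel n c x t > 0" by (intro kernel_pos fin) auto
    moreover have "power_kernel n c y t = 0" using t by (intro kernel_outside) (auto simp: min_def split: if_splits)
    ultimately show False using t assms by simp
  next
    case False
    from ae \<open>x < y\<close> obtain t where t: "x < ereal t" "ereal t < y"
        "a * power_kernel n c y t = b * power_kernel n c x t"
      by (rule AE_lebesgue_meets_einterval)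
    with False have "power_kernel n c y t > 0" by (intro kernel_pos fin) auto
    moreover have "power_kernel n c x t = 0" using t False by (intro kernel_outside) auto
    ultimately show False using t assms by simp
  qed
qed

section \<open>Monotonicity of the quotient of antiderivatives\<close>

text \<open>
  The set \<open>A\<close> stands for the points of \<open>I\<close> outside all exceptional null sets. A coincidence of two
  values of the quotient of antiderivatives forces one of \<open>f / g\<close> on \<open>A\<close>, which is how strictness
  is transferred.
\<close>

lemma antideriv_quotient_increasing:
  assumes n: "n \<ge> 1"
    and I: "ereal_interval I" "n = 1 \<or> I \<subseteq> range ereal" "c \<in> I"
    and f: "locally_lebesgue_integrable_on I f"
    and g: "locally_lebesgue_integrable_on I g"
    and A: "AE t in lebesgue. ereal t \<in> I \<longrightarrow> t \<in> A"
    and g_pos: "\<And>t. t \<in> A \<Longrightarrow> g (ereal t) > 0"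
    and q_mono: "\<And>s t. s \<in> A \<Longrightarrow> t \<in> A \<Longrightarrow> s < t \<Longrightarrow>
      f (ereal s) / g (ereal s) \<le> f (ereal t) / g (ereal t)"
    and xy: "x \<in> I - {c}" "y \<in> I - {c}" "x < y"
  shows "antideriv n f c x / antideriv n g c x \<le> antideriv n f c y / antideriv n g c y"
    and "antideriv n f c x / antideriv n g c x = antideriv n f c y / antideriv n g c y \<Longrightarrow>
      \<exists>s\<in>A. \<exists>t\<in>A. s < t \<and> f (ereal s) / g (ereal s) = f (ereal t) / g (ereal t)"
proof -
  have xyI: "x \<in> I" "x \<noteq> c" "y \<in> I" "y \<noteq> c" using xy by auto
  have fin: "n \<noteq> 1 \<Longrightarrow> \<bar>x\<bar> \<noteq> \<infinity>" "n \<noteq> 1 \<Longrightarrow> \<bar>y\<bar> \<noteq> \<infinity>" using I(2) xyI by auto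
  have "AE t in lebesgue. ereal t \<in> I \<longrightarrow> g (ereal t) > 0"
    using A by eventually_elim (use g_pos in auto)
  then have pos: "(LINT t|lebesgue. g (ereal t) * power_kernel n c x t) > 0"
      "(LINT t|lebesgue. g (ereal t) * power_kernel n c y t) > 0"
    using I g xyI by (blast intro: kernel_integral_pos)+
  have supp: "AE t in lebesgue. t \<notin> A \<longrightarrow> power_kernel n c x t = 0 \<and> power_kernel n c y t = 0"
    using A
  proof eventually_elim
    case (elim t)
    then show ?case
      using kernel_outside[of c _ t n] min_max_in_interval[OF I(1,3) xyI(1), of "ereal t"]
        min_max_in_interval[OF I(1,3) xyI(3), of "ereal t"] by blast
  qed
  note cmp = kernel_average_crossing[where M = lebesgue and A = A
      and f = "\<lambda>t. f (ereal t)" and g = "\<lambda>t. g (ereal t)"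
      and k = "power_kernel n c x" and l = "power_kernel n c y"]
  let ?J = "\<lambda>h x. LINT t|lebesgue. h (ereal t) * power_kernel n c x t"
  have le: "?J f x * ?J g y \<le> ?J f y * ?J g x"
    using integrable_kernel[OF I] xyI f g supp g_pos q_mono kernel_nonneg
      kernel_ratio_mono[OF xy(3) _ fin] kernels_not_proportional[OF xy(3) xyI(2,4) fin pos]
    by (intro cmp(1)) auto
  have eq: "\<exists>s\<in>A. \<exists>t\<in>A. s < t \<and> f (ereal s) / g (ereal s) = f (ereal t) / g (ereal t)"
    if "?J f x * ?J g y = ?J f y * ?J g x"
    using integrable_kernel[OF I] xyI f g supp g_pos q_mono kernel_nonneg that
      kernel_ratio_mono[OF xy(3) _ fin] kernels_not_proportional[OF xy(3) xyI(2,4) fin pos]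
    by (intro cmp(2)) auto
  have Q: "antideriv n f c x / antideriv n g c x = ?J f x / ?J g x"
    by (rule antideriv_quotient_eq_kernel[OF n fin(1)])
  have Q': "antideriv n f c y / antideriv n g c y = ?J f y / ?J g y"
    by (rule antideriv_quotient_eq_kernel[OF n fin(2)])
  show "antideriv n f c x / antideriv n g c x \<le> antideriv n f c y / antideriv n g c y"
    unfolding Q Q' using le pos by (simp add: divide_simps)
  assume "antideriv n f c x / antideriv n g c x = antideriv n f c y / antideriv n g c y"
  then show "\<exists>s\<in>A. \<exists>t\<in>A. s < t \<and> f (ereal s) / g (ereal s) = f (ereal t) / g (ereal t)"
    unfolding Q Q' using pos by (intro eq) (simp add: frac_eq_eq)
qed

text \<open>
  Passing from the extended real quotient to the real one on a set of full measure. The relations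
  \<open>r\<close> and \<open>r'\<close> stand for the four kinds of monotonicity; only comparisons of distinct points are
  extracted, which the weak and the strict order on the arguments have in common.
\<close>

lemma off_null_set_quotient:
  assumes R: "off_null_set_on (\<lambda>A h. monotone_on A r r' h) I q"
    and q: "\<And>x. g x \<noteq> 0 \<Longrightarrow> q x = ereal (f x / g x)"
    and less: "\<And>a b::ereal. a < b \<Longrightarrow> r a b"
    and g_pos: "AE t in lebesgue. ereal t \<in> I \<longrightarrow> g (ereal t) > 0"
  obtains A where "AE t in lebesgue. ereal t \<in> I \<longrightarrow> t \<in> A"
    "\<And>t. t \<in> A \<Longrightarrow> g (ereal t) > 0"
    "\<And>s t. s \<in> A \<Longrightarrow> t \<in> A \<Longrightarrow> s < t \<Longrightarrow>
      r' (ereal (f (ereal s) / g (ereal s))) (ereal (f (ereal t) / g (ereal t)))"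
proof -
  obtain N where N: "ereal -` N \<in> null_sets lebesgue"
      "monotone_on (I - N) r r' q"
    using R by (auto simp: off_null_set_on_def)
  define A where "A = {t. ereal t \<in> I - N \<and> g (ereal t) > 0}"
  show thesis
  proof
    show "AE t in lebesgue. ereal t \<in> I \<longrightarrow> t \<in> A"
      using AE_not_in[OF N(1)] g_pos by eventually_elim (auto simp: A_def)
    show "g (ereal t) > 0" if "t \<in> A" for t using that by (simp add: A_def)
    fix s t assume "s \<in> A" "t \<in> A" "s < t"
    with monotone_onD[OF N(2), of "ereal s" "ereal t"] less q
    show "r' (ereal (f (ereal s) / g (ereal s))) (ereal (f (ereal t) / g (ereal t)))"
      by (auto simp: A_def)
  qed
qed

lemma locally_lebesgue_integrable_on_uminus:
  "locally_lebesgue_integrable_on I h \<Longrightarrow> locally_lebesgue_integrable_on I (\<lambda>x. - h x)"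
  unfolding locally_lebesgue_integrable_on_def set_integrable_def by auto

text \<open>
  The function \<open>q\<close> is constrained only where \<open>g \<noteq> 0\<close>, so that the lemma applies both to
  \<open>f, g\<close> and to \<open>- f, - g\<close> with the same \<open>q\<close>, although \<open>f / 0\<close> and \<open>(- f) / (- 0)\<close> are opposite
  infinities where \<open>f\<close> is not zero.
\<close>

lemma antideriv_quotient_monotone_positive:
  fixes f g :: "ereal \<Rightarrow> real"
  assumes n: "n \<ge> 1"
    and I: "ereal_interval I" "n = 1 \<or> I \<subseteq> range ereal" "c \<in> I"
    and f: "locally_lebesgue_integrable_on I f"
    and g: "locally_lebesgue_integrable_on I g"
    and g_pos: "AE t in lebesgue. ereal t \<in> I \<longrightarrow> g (ereal t) > 0"
    and q: "\<And>x. g x \<noteq> 0 \<Longrightarrow> q x = ereal (f x / g x)"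
  defines "Q \<equiv> \<lambda>x. antideriv n f c x / antideriv n g c x"
  shows "\<forall>x\<in>I - {c}. antideriv n g c x \<noteq> 0"
    and "off_null_set_on mono_on I q \<Longrightarrow> mono_on (I - {c}) Q"
    and "off_null_set_on antimono_on I q \<Longrightarrow> antimono_on (I - {c}) Q"
    and "off_null_set_on strict_mono_on I q \<Longrightarrow> strict_mono_on (I - {c}) Q"
    and "off_null_set_on strict_antimono_on I q \<Longrightarrow> strict_antimono_on (I - {c}) Q"
proof -
  show "\<forall>x\<in>I - {c}. antideriv n g c x \<noteq> 0"
  proof
    fix x assume x: "x \<in> I - {c}"
    then have "n \<noteq> 1 \<Longrightarrow> \<bar>x\<bar> \<noteq> \<infinity>" using I(2) by auto
    moreover have "(LINT t|lebesgue. g (ereal t) * power_kernel n c x t) > 0"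
      using x I g g_pos by (intro kernel_integral_pos) auto
    ultimately show "antideriv n g c x \<noteq> 0"
      using n by (simp add: antideriv_eq_kernel)
  qed
  note incr = antideriv_quotient_increasing[OF n I f g]
  note decr = antideriv_quotient_increasing[OF n I locally_lebesgue_integrable_on_uminus[OF f] g]
  show "mono_on (I - {c}) Q" if R: "off_null_set_on mono_on I q"
  proof (rule monotone_onI)
    fix x y assume xy: "x \<in> I - {c}" "y \<in> I - {c}" "x \<le> y"
    obtain A where "AE t in lebesgue. ereal t \<in> I \<longrightarrow> t \<in> A" "\<And>t. t \<in> A \<Longrightarrow> g (ereal t) > 0"
      "\<And>s t. s \<in> A \<Longrightarrow> t \<in> A \<Longrightarrow> s < t \<Longrightarrow>
        ereal (f (ereal s) / g (ereal s)) \<le> ereal (f (ereal t) / g (ereal t))"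
      by (rule off_null_set_quotient[where f = f, OF R q _ g_pos]) auto
    with incr(1)[of A x y] xy show "Q x \<le> Q y" by (cases "x = y") (auto simp: Q_def)
  qed
  show "antimono_on (I - {c}) Q" if R: "off_null_set_on antimono_on I q"
  proof (rule monotone_onI)
    fix x y assume xy: "x \<in> I - {c}" "y \<in> I - {c}" "x \<le> y"
    obtain A where "AE t in lebesgue. ereal t \<in> I \<longrightarrow> t \<in> A" "\<And>t. t \<in> A \<Longrightarrow> g (ereal t) > 0"
      "\<And>s t. s \<in> A \<Longrightarrow> t \<in> A \<Longrightarrow> s < t \<Longrightarrow>
        ereal (f (ereal s) / g (ereal s)) \<ge> ereal (f (ereal t) / g (ereal t))"
      by (rule off_null_set_quotient[where f = f, OF R q _ g_pos]) auto
    with decr(1)[of A x y] xy show "Q x \<ge> Q y"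
      by (cases "x = y") (auto simp: Q_def antideriv_uminus)
  qed
  show "strict_mono_on (I - {c}) Q" if R: "off_null_set_on strict_mono_on I q"
  proof (rule monotone_onI)
    fix x y assume xy: "x \<in> I - {c}" "y \<in> I - {c}" "x < y"
    obtain A where A: "AE t in lebesgue. ereal t \<in> I \<longrightarrow> t \<in> A" "\<And>t. t \<in> A \<Longrightarrow> g (ereal t) > 0"
      and less: "\<And>s t. s \<in> A \<Longrightarrow> t \<in> A \<Longrightarrow> s < t \<Longrightarrow>
        ereal (f (ereal s) / g (ereal s)) < ereal (f (ereal t) / g (ereal t))"
      by (rule off_null_set_quotient[where f = f, OF R q _ g_pos]) auto
    have "Q x \<le> Q y" "Q x \<noteq> Q y"
      using incr[OF A _ xy] less unfolding Q_def by (fastforce simp: less_imp_le)+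
    then show "Q x < Q y" by simp
  qed
  show "strict_antimono_on (I - {c}) Q" if R: "off_null_set_on strict_antimono_on I q"
  proof (rule monotone_onI)
    fix x y assume xy: "x \<in> I - {c}" "y \<in> I - {c}" "x < y"
    obtain A where A: "AE t in lebesgue. ereal t \<in> I \<longrightarrow> t \<in> A" "\<And>t. t \<in> A \<Longrightarrow> g (ereal t) > 0"
      and less: "\<And>s t. s \<in> A \<Longrightarrow> t \<in> A \<Longrightarrow> s < t \<Longrightarrow>
        ereal (f (ereal s) / g (ereal s)) > ereal (f (ereal t) / g (ereal t))"
      by (rule off_null_set_quotient[where f = f, OF R q _ g_pos]) auto
    have "Q x \<ge> Q y" "Q x \<noteq> Q y"
      using decr[OF A _ xy] less unfolding Q_def
      by (fastforce simp: less_imp_le antideriv_uminus)+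
    then show "Q x > Q y" by simp
  qed
qed

theorem theorem3:
  fixes n :: nat and I :: "ereal set" and c :: ereal and f g :: "ereal \<Rightarrow> real"
  assumes "n \<ge> 1"
    and "ereal_interval I"
    and "n \<noteq> 1 \<Longrightarrow> I \<subseteq> range ereal"
    and "c \<in> I"
    and "locally_lebesgue_integrable_on I f"
    and "locally_lebesgue_integrable_on I g"
    and "preserves_nonzero_sign_ae_on I g"
  shows "let q = (\<lambda>x. ereal (f x) / ereal (g x));
             Q = (\<lambda>x. antideriv n f c x / antideriv n g c x)
    in (\<forall>x \<in> I - {c}. antideriv n g c x \<noteq> 0) \<and>
       (off_null_set_on mono_on I q \<longrightarrow> mono_on (I - {c}) Q) \<and>
       (off_null_set_on antimono_on I q \<longrightarrow> antimono_on (I - {c}) Q) \<and>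
       (off_null_set_on strict_mono_on I q \<longrightarrow> strict_mono_on (I - {c}) Q) \<and>
       (off_null_set_on strict_antimono_on I q \<longrightarrow> strict_antimono_on (I - {c}) Q)"
proof -
  have I: "n = 1 \<or> I \<subseteq> range ereal" using assms(3) by blast
  consider (pos) "AE t in lebesgue. ereal t \<in> I \<longrightarrow> g (ereal t) > 0"
    | (neg) "AE t in lebesgue. ereal t \<in> I \<longrightarrow> - g (ereal t) > 0"
    using assms(7) by (auto simp: preserves_nonzero_sign_ae_on_def)
  then show ?thesis
  proof cases
    case pos
    have "ereal (f x) / ereal (g x) = ereal (f x / g x)" if "g x \<noteq> 0" for x
      using that by simp
    note * = antideriv_quotient_monotone_positive[OF assms(1,2) I assms(4-6) pos this]
    show ?thesis unfolding Let_def by (intro conjI impI *)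
  next
    case neg
    \<comment> \<open>Where \<open>g\<close> vanishes, negating numerator and denominator flips the sign of an
      infinite quotient; the two quotients agree off that null set only.\<close>
    have "ereal (f x) / ereal (g x) = ereal (- f x / - g x)" if "- g x \<noteq> 0" for x
      using that by simp
    note * = antideriv_quotient_monotone_positive[OF assms(1,2) I assms(4)
        assms(5,6)[THEN locally_lebesgue_integrable_on_uminus] neg this,
        unfolded antideriv_uminus minus_divide_divide neg_equal_0_iff_equal]
    show ?thesis unfolding Let_def by (intro conjI impI *)
  qed
qed

end
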